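(* Let $n\ge2$, let $RSC_n=RSC(n,p_1,p_2,p_3)$ be a random spiro chain, and let $a\in\mathbb{R}$. (1) If $h:\{1,2,\dots\}\to(0,\infty)$ and $TI(G)=\sum_{v\in V(G)}h(d_v)^a$, then for $G=RSC_n$ $$TI(G)=2h(2)^a-h(4)^a+\bigl(4h(2)^a+h(4)^a\bigr)n.$$ (2) If $f:\{1,2,\dots\}\times\{1,2,\dots\}\to(0,\infty)$ is symmetric, $TI(G)=\sum_{uv\in E(G)}f(d_v,d_u)^a$, and $TI_n=TI(RSC_n)$, then $$TI_n=A+BX+Cn,$$ $$\mathbb{E}(TI_n)=A+(Bp_1+C)n-2Bp_1,$$ $$V(TI_n)=B^2p_1(1-p_1)(n-2),$$ where $A=4f(2,2)^a-4f(2,4)^a$, $B=f(2,2)^a-2f(2,4)^a+f(4,4)^a$, $C=2f(2,2)^a+4f(2,4)^a$, and $X$ is a random variable having the binomial distribution with parameters $n-2$ and $p_1$. Here $\mathbb{E}$ and $V$ denote expectation and variance.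
   Context: For a finite simple graph $G$, $V(G)$ and $E(G)$ are its vertex and edge sets and $d_v$ is the degree of the vertex $v$. Random spiro chain. Fix $p_1,p_2,p_3$ with $0<p_i<1$ and $p_1+p_2+p_3=1$. The random spiro chain $RSC_n=RSC(n,p_1,p_2,p_3)$ with $n$ hexagons is built as follows. $RSC_1$ is a hexagon $H_1$ (a 6-cycle). $RSC_2$ consists of two hexagons $H_1,H_2$ sharing exactly one vertex. For $n>2$, $RSC_n$ is obtained from $RSC_{n-1}$ by attaching a new hexagon $H_n$ to the last hexagon $H_{n-1}$, identifying one vertex of $H_n$ with a vertex $w$ of $H_{n-1}$, where $w$ is at distance $i\in\{1,2,3\}$ (in the 6-cycle $H_{n-1}$) from the vertex that $H_{n-1}$ shares with $H_{n-2}$. Case $i$ is chosen with probability $p_i$, independently of the previous choices. The identity $TI_n=A+BX+Cn$ asserts that such a random variable $X$ exists (on the same probability space as the chain). *)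

theory Defs
  imports "HOL-Probability.Probability"
begin

text \<open>Edges are unordered pairs, i.e. two-element sets of vertices.\<close>

record 'v graph =
  verts :: "'v set"
  edges :: "'v set set"

definition deg :: "'v graph \<Rightarrow> 'v \<Rightarrow> nat" where
  "deg G v = card {e \<in> edges G. v \<in> e}"

definition graph_dist :: "'v graph \<Rightarrow> 'v \<Rightarrow> 'v \<Rightarrow> nat" where
  "graph_dist G u v = (LEAST k. (u, v) \<in> {(x, y). {x, y} \<in> edges G} ^^ k)"

definition graph_union :: "'v graph \<Rightarrow> 'v graph \<Rightarrow> 'v graph" where
  "graph_union G H = \<lparr>verts = verts G \<union> verts H, edges = edges G \<union> edges H\<rparr>"

definition vertex_index :: "(nat \<Rightarrow> real) \<Rightarrow> real \<Rightarrow> 'v graph \<Rightarrow> real" where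
  "vertex_index h a G = (\<Sum>v\<in>verts G. h (deg G v) powr a)"

text \<open>
  The value attached to an edge does not depend on how its endpoints are ordered as soon as
  \<open>f\<close> is symmetric on positive arguments; only then is the description below meaningful.
\<close>

definition edge_index :: "(nat \<Rightarrow> nat \<Rightarrow> real) \<Rightarrow> real \<Rightarrow> 'v graph \<Rightarrow> real" where
  "edge_index f a G =
     (\<Sum>e\<in>edges G. THE x. \<exists>u v. e = {u, v} \<and> x = f (deg G v) (deg G u) powr a)"

definition hexagon :: "'v graph \<Rightarrow> bool" where
  "hexagon H \<longleftrightarrow> (\<exists>v :: nat \<Rightarrow> 'v. inj_on v {..<6} \<and> verts H = v ` {..<6} \<and>
     edges H = (\<lambda>i. {v i, v (Suc i mod 6)}) ` {..<6})"

text \<open>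
  \<open>spiro_chain c n G L s\<close>: the graph \<open>G\<close> is a spiro chain with \<open>n\<close> hexagons, the last of which
  is \<open>L\<close>; \<open>s\<close> is the vertex that \<open>L\<close> shares with its predecessor (\<open>None\<close> if \<open>n = 1\<close>), and for
  \<open>3 \<le> k \<le> n\<close> the \<open>k\<close>-th hexagon was attached according to case \<open>c k\<close>. Identification of vertices
  is modelled by hexagons overlapping in exactly one vertex. For \<open>c k \<in> {1, 2}\<close> there are two
  admissible attachment vertices, and either may be used.
\<close>

inductive spiro_chain ::
  "(nat \<Rightarrow> nat) \<Rightarrow> nat \<Rightarrow> 'v graph \<Rightarrow> 'v graph \<Rightarrow> 'v option \<Rightarrow> bool" for c where
  first: "hexagon H \<Longrightarrow> spiro_chain c 1 H H None"
| second: "spiro_chain c 1 G L None \<Longrightarrow> hexagon H \<Longrightarrow> verts G \<inter> verts H = {w} \<Longrightarrow>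
     spiro_chain c 2 (graph_union G H) H (Some w)"
| attach: "spiro_chain c n G L (Some s) \<Longrightarrow> hexagon H \<Longrightarrow>
     w \<in> verts L \<Longrightarrow> c (Suc n) \<in> {1, 2, 3} \<Longrightarrow> graph_dist L s w = c (Suc n) \<Longrightarrow>
     verts G \<inter> verts H = {w} \<Longrightarrow>
     spiro_chain c (Suc n) (graph_union G H) H (Some w)"

text \<open>
  \<open>G\<close> is a random spiro chain \<open>RSC(n, p1, p2, p3)\<close> on the probability space \<open>M\<close>; \<open>c k\<close> is the
  random case chosen for the \<open>k\<close>-th hexagon.
\<close>

definition random_spiro_chain ::
  "'w measure \<Rightarrow> nat \<Rightarrow> real \<Rightarrow> real \<Rightarrow> real \<Rightarrow> ('w \<Rightarrow> 'v graph) \<Rightarrow> bool" where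
  "random_spiro_chain M n p1 p2 p3 G \<longleftrightarrow> prob_space M \<and>
     (\<exists>c :: nat \<Rightarrow> 'w \<Rightarrow> nat.
        prob_space.indep_vars M (\<lambda>_. count_space UNIV) c {3..n} \<and>
        (\<forall>k\<in>{3..n}. measure M {\<omega> \<in> space M. c k \<omega> = 1} = p1 \<and>
                    measure M {\<omega> \<in> space M. c k \<omega> = 2} = p2 \<and>
                    measure M {\<omega> \<in> space M. c k \<omega> = 3} = p3) \<and>
        (\<forall>\<omega>\<in>space M. \<exists>L s. spiro_chain (\<lambda>k. c k \<omega>) n (G \<omega>) L s))"

end

theory Submission
  imports Defs
begin

text \<open>
  A spiro chain has only vertices of degree 2 and 4, so both indices are determined by how many
  vertices have degree 2 or 4, and how many edges have the degree set \<open>{2}\<close>, \<open>{2, 4}\<close> or \<open>{4}\<close>.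
  Attaching a hexagon at a vertex \<open>w\<close> changes these counts in a way that only depends on the
  neighbourhood of \<open>w\<close>. The degree of \<open>w\<close> rises from 2 to 4 and five vertices of degree 2 are
  added, whatever the case; hence the vertex index is deterministic.

  For the edges, the new hexagon brings four edges of type \<open>{2}\<close> and two of type \<open>{2, 4}\<close>, and
  the two old edges at \<open>w\<close> are reweighted. In the last hexagon the shared vertex \<open>s\<close> is the only
  one of degree 4. If \<open>w\<close> is adjacent to \<open>s\<close> (case 1), the two old edges turn from types
  \<open>{2, 4}\<close> and \<open>{2}\<close> into \<open>{4}\<close> and \<open>{2, 4}\<close>; otherwise (cases 2 and 3) both turn from
  \<open>{2}\<close> into \<open>{2, 4}\<close>. The gain is thus \<open>C\<close> in cases 2 and 3 and \<open>B + C\<close> in case 1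
  (\<open>sum_edges_attach\<close>), and summing over the chain gives \<open>A + B X + C n\<close>, where \<open>X\<close>
  counts the occurrences of case 1 among the hexagons \<open>3, \<dots>, n\<close> (\<open>spiro_chain_sum_edges\<close>).

  The choices are independent and each is case 1 with probability \<open>p1\<close>, so \<open>X\<close> is binomial
  (\<open>distr_card_indep_eq_binomial\<close>), and the expectation and the variance are those of an affine
  image of a binomial variable.
\<close>

section \<open>Degrees in a union of two graphs with one common vertex\<close>

definition simple_graph :: "'v graph \<Rightarrow> bool" where
  "simple_graph G \<longleftrightarrow> finite (verts G) \<and> (\<forall>e\<in>edges G. e \<subseteq> verts G \<and> card e = 2)"

lemma simple_graph_finite_verts: "simple_graph G \<Longrightarrow> finite (verts G)"
  by (simp add: simple_graph_def)

lemma simple_graph_finite_edges: "simple_graph G \<Longrightarrow> finite (edges G)"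
  by (rule finite_subset[of _ "Pow (verts G)"]) (auto simp: simple_graph_def)

lemma verts_graph_union [simp]: "verts (graph_union G H) = verts G \<union> verts H"
  and edges_graph_union [simp]: "edges (graph_union G H) = edges G \<union> edges H"
  by (simp_all add: graph_union_def)

lemma simple_graph_union:
  "simple_graph G \<Longrightarrow> simple_graph H \<Longrightarrow> simple_graph (graph_union G H)"
  by (auto simp: simple_graph_def)

lemma simple_graph_edgeD:
  assumes "simple_graph G" "e \<in> edges G"
  shows "e \<subseteq> verts G" "card e = 2"
  using assms by (auto simp: simple_graph_def)

lemma deg_outside: assumes "simple_graph G" "v \<notin> verts G" shows "deg G v = 0"
proof -
  have "{e \<in> edges G. v \<in> e} = {}" using simple_graph_edgeD(1)[OF assms(1)] assms(2) by blast
  thus ?thesis unfolding deg_def by (metis card.empty)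
qed

text \<open>A common edge would have both endpoints in the one shared vertex.\<close>

lemma edges_disjoint:
  assumes "simple_graph G" "simple_graph H" "verts G \<inter> verts H = {w}"
  shows "edges G \<inter> edges H = {}"
proof (rule ccontr)
  assume "edges G \<inter> edges H \<noteq> {}"
  then obtain e where "e \<in> edges G" "e \<in> edges H" by auto
  hence "e \<subseteq> verts G \<inter> verts H" "card e = 2" using assms simple_graph_edgeD by blast+
  hence "e \<subseteq> {w}" "card e = 2" using assms(3) by simp_all
  thus False using card_mono[of "{w}" e] by simp
qed

lemma deg_graph_union:
  assumes "simple_graph G" "simple_graph H" "verts G \<inter> verts H = {w}"
  shows "deg (graph_union G H) v = deg G v + deg H v"
proof -
  have "{e \<in> edges (graph_union G H). v \<in> e} = {e \<in> edges G. v \<in> e} \<union> {e \<in> edges H. v \<in> e}"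
    by auto
  moreover have "{e \<in> edges G. v \<in> e} \<inter> {e \<in> edges H. v \<in> e} = {}"
    using edges_disjoint[OF assms] by auto
  ultimately show ?thesis
    using assms(1,2) by (simp add: deg_def card_Un_disjoint simple_graph_finite_edges)
qed

lemma deg_graph_union_unshared:
  assumes "simple_graph G" "simple_graph H" "verts G \<inter> verts H = {w}" "v \<noteq> w"
  shows "v \<in> verts G \<Longrightarrow> deg (graph_union G H) v = deg G v"
    and "v \<in> verts H \<Longrightarrow> deg (graph_union G H) v = deg H v"
proof -
  have "v \<notin> verts G \<inter> verts H" using assms(3,4) by simp
  thus "v \<in> verts G \<Longrightarrow> deg (graph_union G H) v = deg G v"
    and "v \<in> verts H \<Longrightarrow> deg (graph_union G H) v = deg H v"
    using assms(1,2) by (simp_all add: deg_graph_union[OF assms(1-3)] deg_outside)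
qed

lemma sum_verts_graph_union:
  fixes \<phi> :: "nat \<Rightarrow> real"
  assumes G: "simple_graph G" and H: "simple_graph H" and GH: "verts G \<inter> verts H = {w}"
  shows "(\<Sum>v\<in>verts (graph_union G H). \<phi> (deg (graph_union G H) v)) =
           (\<Sum>v\<in>verts G. \<phi> (deg G v)) + (\<Sum>v\<in>verts H. \<phi> (deg H v))
           + \<phi> (deg G w + deg H w) - \<phi> (deg G w) - \<phi> (deg H w)"
proof -
  have fin: "finite (verts G)" "finite (verts H)"
    using G H by (auto simp: simple_graph_finite_verts)
  have w: "w \<in> verts G" "w \<in> verts H" using GH by auto
  let ?D = "\<lambda>v. \<phi> (deg (graph_union G H) v)"
  have "verts G \<union> verts H = insert w ((verts G - {w}) \<union> (verts H - {w}))" using w by auto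
  hence "sum ?D (verts G \<union> verts H) = ?D w + sum ?D ((verts G - {w}) \<union> (verts H - {w}))"
    using fin by simp
  also have "sum ?D ((verts G - {w}) \<union> (verts H - {w})) =
      sum ?D (verts G - {w}) + sum ?D (verts H - {w})"
    by (rule sum.union_disjoint) (use fin GH in auto)
  also have "sum ?D (verts G - {w}) = (\<Sum>v\<in>verts G - {w}. \<phi> (deg G v))"
    by (rule sum.cong) (simp_all add: deg_graph_union_unshared[OF G H GH])
  also have "sum ?D (verts H - {w}) = (\<Sum>v\<in>verts H - {w}. \<phi> (deg H v))"
    by (rule sum.cong) (simp_all add: deg_graph_union_unshared[OF G H GH])
  finally show ?thesis
    using fin w by (simp add: deg_graph_union[OF G H GH] sum_diff1)
qed

text \<open>
  Changing a vertex labelling at the single vertex \<open>w\<close> affects only the edges at \<open>w\<close>, which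
  correspond to its neighbours. Taking the image of an edge under the labelling makes the weight
  of an edge independent of the order of its endpoints. In a union with one shared vertex, the
  degrees in either part change at that vertex alone, so this applies to both parts.
\<close>

lemma sum_edges_reweight:
  fixes g :: "nat set \<Rightarrow> real"
  assumes G: "simple_graph G" and D: "\<And>x. x \<in> verts G \<Longrightarrow> x \<noteq> w \<Longrightarrow> D' x = D x"
  shows "(\<Sum>e\<in>edges G. g (D' ` e)) =
           (\<Sum>e\<in>edges G. g (D ` e))
           + (\<Sum>x | {w, x} \<in> edges G. g {D' w, D x} - g {D w, D x})"
proof -
  have nbr: "x \<noteq> w \<and> x \<in> verts G" if "{w, x} \<in> edges G" for x
    using that G by (auto simp: simple_graph_def)
  have image: "{e \<in> edges G. w \<in> e} = (\<lambda>x. {w, x}) ` {x. {w, x} \<in> edges G}" (is "?L = ?R")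
  proof
    show "?L \<subseteq> ?R"
    proof
      fix e assume e: "e \<in> ?L"
      hence "card e = 2" using G by (auto simp: simple_graph_def)
      then obtain x y where "e = {x, y}" by (auto simp: card_2_iff)
      with e have "e = {w, x} \<or> e = {w, y}" by auto
      with e show "e \<in> ?R" by auto
    qed
  qed auto
  have inj: "inj_on (\<lambda>x. {w, x}) {x. {w, x} \<in> edges G}"
    by (auto simp: inj_on_def doubleton_eq_iff)
  have "(\<Sum>e\<in>edges G. g (D' ` e)) - (\<Sum>e\<in>edges G. g (D ` e))
      = (\<Sum>e\<in>edges G. g (D' ` e) - g (D ` e))"
    by (simp add: sum_subtractf)
  also have "\<dots> = (\<Sum>e\<in>{e \<in> edges G. w \<in> e}. g (D' ` e) - g (D ` e))"
  proof (rule sum.mono_neutral_right)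
    show "\<forall>e\<in>edges G - {e \<in> edges G. w \<in> e}. g (D' ` e) - g (D ` e) = 0"
    proof
      fix e assume e: "e \<in> edges G - {e \<in> edges G. w \<in> e}"
      have "D' ` e = D ` e"
        by (rule image_cong) (use e D G in \<open>auto simp: simple_graph_def\<close>)
      thus "g (D' ` e) - g (D ` e) = 0" by simp
    qed
  qed (use G in \<open>auto simp: simple_graph_finite_edges\<close>)
  also have "\<dots> = (\<Sum>x | {w, x} \<in> edges G. g {D' w, D x} - g {D w, D x})"
    unfolding image by (subst sum.reindex[OF inj]) (auto simp: D nbr intro!: sum.cong)
  finally show ?thesis by simp
qed

section \<open>Hexagons\<close>

text \<open>
  By rotational symmetry the cyclic enumeration may start at any vertex. With the six vertices
  and edges explicit, degrees, neighbours and cardinalities can be read off.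
\<close>

lemma hexagon_from_vertexE:
  assumes "hexagon H" "w \<in> verts H"
  obtains a b c d e where "distinct [w, a, b, c, d, e]" "verts H = {w, a, b, c, d, e}"
    "edges H = {{w, a}, {a, b}, {b, c}, {c, d}, {d, e}, {e, w}}"
proof -
  from assms(1) obtain v :: "nat \<Rightarrow> 'a" where inj: "inj_on v {..<6}"
    and V: "verts H = v ` {..<6}" and E: "edges H = (\<lambda>i. {v i, v (Suc i mod 6)}) ` {..<6}"
    unfolding hexagon_def by blast
  have six: "{..<6::nat} = {0, 1, 2, 3, 4, 5}" by auto
  have neq: "i < 6 \<Longrightarrow> j < 6 \<Longrightarrow> v i = v j \<longleftrightarrow> i = j" for i j
    using inj by (auto simp: inj_on_def)
  have V6: "verts H = {v 0, v 1, v 2, v 3, v 4, v 5}"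
    unfolding V six by simp
  have E6: "edges H = {{v 0, v 1}, {v 1, v 2}, {v 2, v 3}, {v 3, v 4}, {v 4, v 5}, {v 5, v 0}}"
  proof -
    have "Suc 0 mod 6 = 1" "Suc 1 mod 6 = 2" "Suc 2 mod 6 = 3" "Suc 3 mod 6 = 4"
      "Suc 4 mod 6 = 5" "Suc 5 mod 6 = 0" by simp_all
    thus ?thesis unfolding E six by (simp only: image_insert image_empty)
  qed
  from assms(2) V6 consider "w = v 0" | "w = v 1" | "w = v 2" | "w = v 3" | "w = v 4" | "w = v 5"
    by auto
  thus thesis
  proof cases
    case 1 show thesis
      by (rule that[of "v 1" "v 2" "v 3" "v 4" "v 5"]) (simp_all add: 1 V6 E6 neq insert_commute)
  next
    case 2 show thesis
      by (rule that[of "v 2" "v 3" "v 4" "v 5" "v 0"]) (simp_all add: 2 V6 E6 neq insert_commute)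
  next
    case 3 show thesis
      by (rule that[of "v 3" "v 4" "v 5" "v 0" "v 1"]) (simp_all add: 3 V6 E6 neq insert_commute)
  next
    case 4 show thesis
      by (rule that[of "v 4" "v 5" "v 0" "v 1" "v 2"]) (simp_all add: 4 V6 E6 neq insert_commute)
  next
    case 5 show thesis
      by (rule that[of "v 5" "v 0" "v 1" "v 2" "v 3"]) (simp_all add: 5 V6 E6 neq insert_commute)
  next
    case 6 show thesis
      by (rule that[of "v 0" "v 1" "v 2" "v 3" "v 4"]) (simp_all add: 6 V6 E6 neq insert_commute)
  qed
qed

lemma hexagon_nonempty: "hexagon H \<Longrightarrow> verts H \<noteq> {}"
  by (auto simp: hexagon_def lessThan_empty_iff)

lemma hexagon_simple: assumes "hexagon H" shows "simple_graph H"
proof -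
  obtain w where "w \<in> verts H" using hexagon_nonempty[OF assms] by auto
  with assms show ?thesis
    by (rule hexagon_from_vertexE) (auto simp: simple_graph_def card_insert_if)
qed

lemma hexagon_deg: assumes "hexagon H" "w \<in> verts H" shows "deg H w = 2"
  using assms
proof (rule hexagon_from_vertexE)
  fix a b c d e
  assume dist: "distinct [w, a, b, c, d, e]"
    and E: "edges H = {{w, a}, {a, b}, {b, c}, {c, d}, {d, e}, {e, w}}"
  have "{f \<in> edges H. w \<in> f} = {{w, a}, {e, w}}" using dist unfolding E by auto
  thus ?thesis using dist by (simp add: deg_def doubleton_eq_iff)
qed

lemma hexagon_neighboursE:
  assumes "hexagon H" "w \<in> verts H"
  obtains x y where "x \<noteq> y" "x \<noteq> w" "y \<noteq> w" "x \<in> verts H" "y \<in> verts H"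
    "{z. {w, z} \<in> edges H} = {x, y}"
  using assms
proof (rule hexagon_from_vertexE)
  fix a b c d e
  assume dist: "distinct [w, a, b, c, d, e]" and V: "verts H = {w, a, b, c, d, e}"
    and E: "edges H = {{w, a}, {a, b}, {b, c}, {c, d}, {d, e}, {e, w}}"
  have "{w, z} \<in> edges H \<longleftrightarrow> z = a \<or> z = e" for z
    using dist unfolding E by (simp add: doubleton_eq_iff eq_commute)
  hence "{z. {w, z} \<in> edges H} = {a, e}" by auto
  thus thesis using dist by (intro that[of a e]) (auto simp: V)
qed

lemma hexagon_sum_verts:
  fixes \<phi> :: "nat \<Rightarrow> real"
  assumes "hexagon H" shows "(\<Sum>v\<in>verts H. \<phi> (deg H v)) = 6 * \<phi> 2"
proof -
  obtain w where "w \<in> verts H" using hexagon_nonempty[OF assms] by auto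
  with assms have "card (verts H) = 6" by (rule hexagon_from_vertexE) auto
  thus ?thesis using hexagon_deg[OF assms] by simp
qed

lemma hexagon_sum_edges:
  fixes g :: "nat set \<Rightarrow> real"
  assumes "hexagon H" shows "(\<Sum>e\<in>edges H. g (deg H ` e)) = 6 * g {2}"
proof -
  obtain w where "w \<in> verts H" using hexagon_nonempty[OF assms] by auto
  with assms have "card (edges H) = 6"
    by (rule hexagon_from_vertexE) (auto simp: card_insert_if doubleton_eq_iff)
  moreover have "deg H ` e = {2}" if "e \<in> edges H" for e
  proof -
    have "e \<subseteq> verts H" "e \<noteq> {}" using that hexagon_simple[OF assms] by (auto simp: simple_graph_def)
    hence "deg H ` e = (\<lambda>_. 2) ` e"
      using hexagon_deg[OF assms] by (intro image_cong) auto
    thus ?thesis using \<open>e \<noteq> {}\<close> by (simp add: image_constant_conv)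
  qed
  ultimately show ?thesis by simp
qed

lemma graph_dist_refl: "graph_dist G s s = 0"
  unfolding graph_dist_def by (rule Least_equality) auto

text \<open>
  The distance is the least length of a walk, which is a meaningful number only if some walk
  exists; therefore the forward direction relies on the hexagon being connected.
\<close>

lemma graph_dist_eq_1_iff:
  assumes L: "hexagon L" and sw: "s \<in> verts L" "w \<in> verts L"
  shows "graph_dist L s w = 1 \<longleftrightarrow> {s, w} \<in> edges L"
proof -
  let ?R = "{(x, y). {x, y} \<in> edges L}"
  have "\<exists>k. (s, w) \<in> ?R ^^ k"
    using L sw(1)
  proof (rule hexagon_from_vertexE)
    fix a b c d e
    assume V: "verts L = {s, a, b, c, d, e}"
      and E: "edges L = {{s, a}, {a, b}, {b, c}, {c, d}, {d, e}, {e, s}}"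
    have R: "(s, a) \<in> ?R" "(a, b) \<in> ?R" "(b, c) \<in> ?R" "(c, d) \<in> ?R" "(d, e) \<in> ?R"
      unfolding E by auto
    have 1: "(s, a) \<in> ?R\<^sup>*" using R(1) by (rule r_into_rtrancl)
    have 2: "(s, b) \<in> ?R\<^sup>*" using 1 R(2) by (rule rtrancl_into_rtrancl)
    have 3: "(s, c) \<in> ?R\<^sup>*" using 2 R(3) by (rule rtrancl_into_rtrancl)
    have 4: "(s, d) \<in> ?R\<^sup>*" using 3 R(4) by (rule rtrancl_into_rtrancl)
    have 5: "(s, e) \<in> ?R\<^sup>*" using 4 R(5) by (rule rtrancl_into_rtrancl)
    have "(s, w) \<in> ?R\<^sup>*" using 1 2 3 4 5 sw(2) unfolding V by auto
    thus ?thesis by (rule rtrancl_imp_relpow)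
  qed
  hence path: "(s, w) \<in> ?R ^^ graph_dist L s w"
    unfolding graph_dist_def by (rule LeastI_ex)
  show ?thesis
  proof
    assume "graph_dist L s w = 1"
    with path show "{s, w} \<in> edges L" by simp
  next
    assume edge: "{s, w} \<in> edges L"
    hence "graph_dist L s w \<le> 1" unfolding graph_dist_def by (intro Least_le) simp
    moreover have "s \<noteq> w" using edge hexagon_simple[OF L] by (auto simp: simple_graph_def)
    hence "graph_dist L s w \<noteq> 0" using path by (metis relpow_0_E)
    ultimately show "graph_dist L s w = 1" by simp
  qed
qed

section \<open>The degree statistics of a spiro chain\<close>

text \<open>
  The invariant of the construction: in the last hexagon \<open>L\<close>, every vertex except the one shared
  with the preceding hexagon (if there is one) still has all its edges inside \<open>L\<close>, and the shared
  vertex has degree 4. This is what fixes the degrees around the next attachment vertex.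
\<close>

definition hexagonal_end :: "'v graph \<Rightarrow> 'v graph \<Rightarrow> 'v option \<Rightarrow> bool" where
  "hexagonal_end G L s \<longleftrightarrow> simple_graph G \<and> hexagon L \<and> verts L \<subseteq> verts G \<and>
     (\<forall>v\<in>verts L. Some v \<noteq> s \<longrightarrow> {e \<in> edges G. v \<in> e} = {e \<in> edges L. v \<in> e}) \<and>
     (\<forall>v\<in>verts G. deg G v \<in> {2, 4}) \<and>
     (\<forall>v. s = Some v \<longrightarrow> v \<in> verts L \<and> deg G v = 4)"

lemma hexagonal_end_deg_2:
  "hexagonal_end G L s \<Longrightarrow> v \<in> verts L \<Longrightarrow> Some v \<noteq> s \<Longrightarrow> deg G v = 2"
  using hexagon_deg[of L v] by (simp add: hexagonal_end_def deg_def)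

lemma hexagonal_end_hexagon:
  assumes "hexagon H" shows "hexagonal_end H H None"
  using assms by (auto simp: hexagonal_end_def hexagon_simple hexagon_deg)

lemma hexagonal_end_graph_union:
  assumes G: "hexagonal_end G L s" and H: "hexagon H" and GH: "verts G \<inter> verts H = {w}"
    and w: "w \<in> verts L" "Some w \<noteq> s"
  shows "hexagonal_end (graph_union G H) H (Some w)"
proof -
  have sG: "simple_graph G" and sH: "simple_graph H"
    using G H by (auto simp: hexagonal_end_def hexagon_simple)
  note deg = deg_graph_union[OF sG sH GH]
  have wH: "w \<in> verts H" using GH by auto
  have dw: "deg (graph_union G H) w = 4"
    using hexagonal_end_deg_2[OF G w] hexagon_deg[OF H wH] by (simp add: deg)
  have "deg (graph_union G H) v \<in> {2, 4}" if "v \<in> verts (graph_union G H)" for v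
  proof (cases "v \<in> verts G")
    case True
    show ?thesis
    proof (cases "v = w")
      case False
      with True GH have "v \<notin> verts H" by auto
      with True G show ?thesis by (auto simp: deg deg_outside[OF sH] hexagonal_end_def)
    qed (simp add: dw)
  next
    case False
    with that show ?thesis by (auto simp: deg deg_outside[OF sG] hexagon_deg[OF H])
  qed
  moreover have "{e \<in> edges (graph_union G H). v \<in> e} = {e \<in> edges H. v \<in> e}"
    if "v \<in> verts H" "v \<noteq> w" for v
  proof -
    have "v \<notin> verts G" using that GH by auto
    thus ?thesis using sG by (auto simp: simple_graph_def)
  qed
  ultimately show ?thesis
    using dw wH H by (auto simp: hexagonal_end_def simple_graph_union[OF sG sH])
qed

text \<open>
  A new hexagon is never attached at the shared vertex, because that vertex is at distance 0
  from itself.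
\<close>

lemma spiro_chain_hexagonal_end:
  "spiro_chain c n G L s \<Longrightarrow> hexagonal_end G L s"
proof (induction rule: spiro_chain.induct)
  case (first H)
  thus ?case by (rule hexagonal_end_hexagon)
next
  case (second G L H w)
  have "verts G = verts L"
    using second.hyps(1) by cases auto
  with second show ?case by (intro hexagonal_end_graph_union) auto
next
  case (attach n G L s H w)
  have "w \<noteq> s" using attach.hyps graph_dist_refl[of L s] by auto
  with attach show ?case by (intro hexagonal_end_graph_union[where s = "Some s"]) auto
qed

lemma sum_verts_attach:
  fixes \<phi> :: "nat \<Rightarrow> real"
  assumes G: "hexagonal_end G L s" and H: "hexagon H" and GH: "verts G \<inter> verts H = {w}"
    and w: "w \<in> verts L" "Some w \<noteq> s"
  shows "(\<Sum>v\<in>verts (graph_union G H). \<phi> (deg (graph_union G H) v)) =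
           (\<Sum>v\<in>verts G. \<phi> (deg G v)) + 4 * \<phi> 2 + \<phi> 4"
proof -
  have sG: "simple_graph G" and sH: "simple_graph H" and "w \<in> verts H"
    using G H GH by (auto simp: hexagonal_end_def hexagon_simple)
  thus ?thesis
    using hexagonal_end_deg_2[OF G w] hexagon_deg[OF H]
    unfolding sum_verts_graph_union[OF sG sH GH] hexagon_sum_verts[OF H] by simp
qed

text \<open>
  The two old edges at \<open>w\<close> go to its neighbours \<open>p\<close> and \<open>q\<close> in the last hexagon; both of
  these have degree 2, unless one of them is the shared vertex. On the side of the new hexagon
  \<open>H\<close>, both neighbours of \<open>w\<close> have degree 2.
\<close>

lemma sum_edges_attach:
  fixes g :: "nat set \<Rightarrow> real"
  assumes G: "hexagonal_end G L s" and H: "hexagon H" and GH: "verts G \<inter> verts H = {w}"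
    and w: "w \<in> verts L" "Some w \<noteq> s"
  shows "(\<Sum>e\<in>edges (graph_union G H). g (deg (graph_union G H) ` e)) =
           (\<Sum>e\<in>edges G. g (deg G ` e)) +
           (if \<exists>v. s = Some v \<and> {v, w} \<in> edges L
            then 3 * g {2} + 2 * g {2, 4} + g {4} else 2 * g {2} + 4 * g {2, 4})"
proof -
  have sG: "simple_graph G" and sH: "simple_graph H" and L: "hexagon L" and wH: "w \<in> verts H"
    using G H GH by (auto simp: hexagonal_end_def hexagon_simple)
  let ?U = "graph_union G H"
  note deg = deg_graph_union[OF sG sH GH]
  have dGw: "deg G w = 2" by (rule hexagonal_end_deg_2[OF G w])
  have dUw: "deg ?U w = 4" using hexagon_deg[OF H wH] by (simp add: deg dGw)
  obtain x y where xy: "x \<noteq> y" "x \<in> verts H" "y \<in> verts H" "{z. {w, z} \<in> edges H} = {x, y}"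
    using H wH by (rule hexagon_neighboursE)
  have "(\<Sum>e\<in>edges H. g (deg ?U ` e)) =
      (\<Sum>e\<in>edges H. g (deg H ` e)) +
      (\<Sum>x | {w, x} \<in> edges H. g {deg ?U w, deg H x} - g {deg H w, deg H x})"
    by (rule sum_edges_reweight[OF sH]) (rule deg_graph_union_unshared[OF sG sH GH])
  also have "\<dots> = 4 * g {2} + 2 * g {2, 4}"
    using xy wH by (simp add: hexagon_sum_edges[OF H] hexagon_deg[OF H] dUw insert_commute)
  finally have sumH: "(\<Sum>e\<in>edges H. g (deg ?U ` e)) = 4 * g {2} + 2 * g {2, 4}" .
  obtain p q where pq: "p \<noteq> q" "p \<noteq> w" "q \<noteq> w" "p \<in> verts L" "q \<in> verts L"
    "{z. {w, z} \<in> edges L} = {p, q}"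
    using L w(1) by (rule hexagon_neighboursE)
  have "{e \<in> edges G. w \<in> e} = {e \<in> edges L. w \<in> e}"
    using G w by (auto simp: hexagonal_end_def)
  hence nbrs: "{z. {w, z} \<in> edges G} = {p, q}" using pq(6) by blast
  have "(\<Sum>e\<in>edges G. g (deg ?U ` e)) =
      (\<Sum>e\<in>edges G. g (deg G ` e)) +
      (\<Sum>x | {w, x} \<in> edges G. g {deg ?U w, deg G x} - g {deg G w, deg G x})"
    by (rule sum_edges_reweight[OF sG]) (rule deg_graph_union_unshared[OF sG sH GH])
  also have "\<dots> = (\<Sum>e\<in>edges G. g (deg G ` e)) +
      ((g {4, deg G p} - g {2, deg G p}) + (g {4, deg G q} - g {2, deg G q}))"
    using pq(1) by (simp add: nbrs dUw dGw)
  also have "(g {4, deg G p} - g {2, deg G p}) + (g {4, deg G q} - g {2, deg G q}) =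
      (if \<exists>v. s = Some v \<and> {v, w} \<in> edges L then g {4} - g {2} else 2 * g {2, 4} - 2 * g {2})"
  proof -
    have adj: "{v, w} \<in> edges L \<longleftrightarrow> v = p \<or> v = q" for v
      using pq(6) by (auto simp: insert_commute)
    have d4: "deg G v = 4" if "s = Some v" for v using G that by (auto simp: hexagonal_end_def)
    note d2 = hexagonal_end_deg_2[OF G pq(4)] hexagonal_end_deg_2[OF G pq(5)]
    consider "s = Some p" | "s = Some q" | "s \<noteq> Some p" "s \<noteq> Some q" by blast
    thus ?thesis
    proof cases
      case 1 thus ?thesis using d2 d4 pq(1) by (auto simp: adj insert_commute)
    next
      case 2 thus ?thesis using d2 d4 pq(1) by (auto simp: adj insert_commute)
    next
      case 3 thus ?thesis using d2 by (auto simp: adj insert_commute)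
    qed
  qed
  finally have sumG: "(\<Sum>e\<in>edges G. g (deg ?U ` e)) = (\<Sum>e\<in>edges G. g (deg G ` e)) +
      (if \<exists>v. s = Some v \<and> {v, w} \<in> edges L then g {4} - g {2} else 2 * g {2, 4} - 2 * g {2})"
    by simp
  have "(\<Sum>e\<in>edges ?U. g (deg ?U ` e)) =
      (\<Sum>e\<in>edges G. g (deg ?U ` e)) + (\<Sum>e\<in>edges H. g (deg ?U ` e))"
    unfolding edges_graph_union
    by (rule sum.union_disjoint)
       (use sG sH edges_disjoint[OF sG sH GH] in \<open>auto simp: simple_graph_finite_edges\<close>)
  thus ?thesis unfolding sumG sumH by auto
qed

lemma spiro_chain_sum_verts:
  fixes \<phi> :: "nat \<Rightarrow> real"
  assumes "spiro_chain c n G L s"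
  shows "(\<Sum>v\<in>verts G. \<phi> (deg G v)) = 2 * \<phi> 2 - \<phi> 4 + (4 * \<phi> 2 + \<phi> 4) * real n"
  using assms
proof (induction rule: spiro_chain.induct)
  case (first H)
  thus ?case by (simp add: hexagon_sum_verts)
next
  case (second G L H w)
  have "w \<in> verts L" using second.hyps(1,3) by cases auto
  with second show ?case
    by (simp add: sum_verts_attach[OF spiro_chain_hexagonal_end] del: verts_graph_union)
next
  case (attach n G L s H w)
  have "w \<noteq> s" using attach.hyps graph_dist_refl[of L s] by auto
  with attach show ?case
    by (simp add: sum_verts_attach[OF spiro_chain_hexagonal_end] algebra_simps
             del: verts_graph_union)
qed

text \<open>
  The formula already holds for a single hexagon, and the second attachment, at an arbitrary
  vertex, has the same effect as case 2 or 3. So the induction starts at one hexagon and only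
  the hexagons from the third on can contribute to the number of case 1 choices.
\<close>

lemma spiro_chain_sum_edges:
  fixes g :: "nat set \<Rightarrow> real"
  assumes "spiro_chain c n G L s"
  shows "(\<Sum>e\<in>edges G. g (deg G ` e)) =
           (4 * g {2} - 4 * g {2, 4})
           + (g {2} - 2 * g {2, 4} + g {4}) * real (card {k \<in> {3..n}. c k = 1})
           + (2 * g {2} + 4 * g {2, 4}) * real n"
  using assms
proof (induction rule: spiro_chain.induct)
  case (first H)
  thus ?case by (simp add: hexagon_sum_edges)
next
  case (second G L H w)
  have "w \<in> verts L" using second.hyps(1,3) by cases auto
  with second show ?case
    by (simp add: sum_edges_attach[OF spiro_chain_hexagonal_end] del: edges_graph_union)
next
  case (attach n G L s H w)
  have "w \<noteq> s" using attach.hyps graph_dist_refl[of L s] by auto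
  note L = spiro_chain_hexagonal_end[OF attach.hyps(1)]
  have "hexagon L" "s \<in> verts L" using L by (auto simp: hexagonal_end_def)
  hence adj: "{s, w} \<in> edges L \<longleftrightarrow> c (Suc n) = 1"
    using graph_dist_eq_1_iff[of L s w] attach.hyps by auto
  have "n \<ge> 2" using attach.hyps(1)
    by (induction n G L "Some s" arbitrary: s rule: spiro_chain.induct) auto
  hence "{3..Suc n} = insert (Suc n) {3..n}" by auto
  hence "{k \<in> {3..Suc n}. c k = 1} =
      (if c (Suc n) = 1 then insert (Suc n) {k \<in> {3..n}. c k = 1} else {k \<in> {3..n}. c k = 1})"
    by auto
  hence "card {k \<in> {3..Suc n}. c k = 1} =
      card {k \<in> {3..n}. c k = 1} + (if c (Suc n) = 1 then 1 else 0)"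
    by simp
  moreover have "(\<Sum>e\<in>edges (graph_union G H). g (deg (graph_union G H) ` e)) =
      (\<Sum>e\<in>edges G. g (deg G ` e)) +
      (if c (Suc n) = 1 then 3 * g {2} + 2 * g {2, 4} + g {4} else 2 * g {2} + 4 * g {2, 4})"
    using sum_edges_attach[OF L attach.hyps(2,6,3), of g] \<open>w \<noteq> s\<close> by (simp add: adj)
  ultimately show ?case
    unfolding attach.IH by (cases "c (Suc n) = 1") (simp_all add: algebra_simps)
qed

lemma vertex_index_spiro_chain:
  assumes "spiro_chain c n G L s"
  shows "vertex_index h a G =
           2 * h 2 powr a - h 4 powr a + (4 * h 2 powr a + h 4 powr a) * real n"
  unfolding vertex_index_def by (rule spiro_chain_sum_verts[OF assms])

lemma edge_index_spiro_chain:
  assumes chain: "spiro_chain c n G L s" and sym: "f 2 4 = f 4 2"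
  shows "edge_index f a G =
           (4 * f 2 2 powr a - 4 * f 2 4 powr a)
           + (f 2 2 powr a - 2 * f 2 4 powr a + f 4 4 powr a)
             * real (card {k \<in> {3..n}. c k = 1})
           + (2 * f 2 2 powr a + 4 * f 2 4 powr a) * real n"
proof -
  (* Since only the degrees 2 and 4 occur, the degree set of an edge determines its value. The
     last branch is meant for {2, 4}. *)
  define g where "g = (\<lambda>D. if D = {2::nat} then f 2 2 powr a
    else if D = {4} then f 4 4 powr a else f 2 4 powr a)"
  have G: "hexagonal_end G L s" using chain by (rule spiro_chain_hexagonal_end)
  have "edge_index f a G = (\<Sum>e\<in>edges G. g (deg G ` e))"
    unfolding edge_index_def
  proof (rule sum.cong[OF refl])
    fix e assume e: "e \<in> edges G"
    hence "card e = 2" "e \<subseteq> verts G" using G by (auto simp: hexagonal_end_def simple_graph_def)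
    then obtain u v where uv: "e = {u, v}" by (auto simp: card_2_iff)
    have val: "g {deg G x, deg G y} = f (deg G y) (deg G x) powr a" if "e = {x, y}" for x y
    proof -
      have "deg G x \<in> {2, 4}" "deg G y \<in> {2, 4}"
        using that \<open>e \<subseteq> verts G\<close> G by (auto simp: hexagonal_end_def)
      thus ?thesis using sym by (auto simp: g_def doubleton_eq_iff)
    qed
    show "(THE x. \<exists>u v. e = {u, v} \<and> x = f (deg G v) (deg G u) powr a) = g (deg G ` e)"
    proof (rule the_equality)
      show "\<exists>u v. e = {u, v} \<and> g (deg G ` e) = f (deg G v) (deg G u) powr a"
        using uv val[OF uv] by auto
    next
      fix x assume "\<exists>u v. e = {u, v} \<and> x = f (deg G v) (deg G u) powr a"
      then obtain u v where "e = {u, v}" "x = f (deg G v) (deg G u) powr a" by auto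
      thus "x = g (deg G ` e)" using val by auto
    qed
  qed
  also have "\<dots> = (4 * g {2} - 4 * g {2, 4})
           + (g {2} - 2 * g {2, 4} + g {4}) * real (card {k \<in> {3..n}. c k = 1})
           + (2 * g {2} + 4 * g {2, 4}) * real n"
    by (rule spiro_chain_sum_edges[OF chain])
  finally show ?thesis by (simp add: g_def doubleton_eq_iff)
qed

section \<open>The binomial distribution\<close>

text \<open>
  The point masses of the binomial distribution are the Bernstein polynomials evaluated at \<open>p\<close>,
  so its first two moments are the classical identities behind Bernstein's approximation theorem.
\<close>

lemma expectation_binomial_eq_Bernstein:
  fixes f :: "nat \<Rightarrow> real"
  assumes "p \<in> {0..1}"
  shows "measure_pmf.expectation (binomial_pmf n p) f = (\<Sum>k\<le>n. f k * Bernstein n k p)"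
  unfolding expectation_binomial_pmf'[OF assms]
  by (rule sum.cong) (simp_all add: Bernstein_def)

lemma expectation_binomial_pmf:
  assumes p: "p \<in> {0..1}"
  shows "measure_pmf.expectation (binomial_pmf n p) real = real n * p"
  unfolding expectation_binomial_eq_Bernstein[OF p] by (rule sum_k_Bernstein)

lemma variance_binomial_pmf:
  assumes p: "p \<in> {0..1}"
  shows "measure_pmf.variance (binomial_pmf n p) real = real n * p * (1 - p)"
proof -
  have "measure_pmf.expectation (binomial_pmf n p) (\<lambda>k. real k * (real k - 1)) =
      real n * (real n - 1) * p\<^sup>2"
    unfolding expectation_binomial_eq_Bernstein[OF p] by (rule sum_kk_Bernstein)
  moreover have "(\<lambda>k. (real k)\<^sup>2) = (\<lambda>k. real k * (real k - 1) + real k)"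
    by (simp add: fun_eq_iff power2_eq_square right_diff_distrib)
  ultimately have sq: "measure_pmf.expectation (binomial_pmf n p) (\<lambda>k. (real k)\<^sup>2) =
      real n * (real n - 1) * p\<^sup>2 + real n * p"
    by (simp only: Bochner_Integration.integral_add[OF integrable_binomial_pmf integrable_binomial_pmf]
        p expectation_binomial_pmf[OF p])
  have "measure_pmf.variance (binomial_pmf n p) real =
      measure_pmf.expectation (binomial_pmf n p) (\<lambda>k. (real k)\<^sup>2) - (real n * p)\<^sup>2"
    by (subst measure_pmf.variance_eq)
       (simp_all only: integrable_binomial_pmf p expectation_binomial_pmf[OF p])
  also have "\<dots> = real n * p * (1 - p)"
    unfolding sq by (simp add: power2_eq_square algebra_simps)
  finally show ?thesis .
qed

text \<open>
  The event that the count is \<open>m\<close> splits, according to the set \<open>S\<close> of indices where the value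
  \<open>y\<close> is taken, into \<open>card I choose m\<close> disjoint events. By independence, each of them has
  probability \<open>p ^ m * (1 - p) ^ (card I - m)\<close>.
\<close>

lemma (in prob_space) distr_card_indep_eq_binomial:
  assumes I: "finite I"
    and indep: "indep_vars (\<lambda>_. count_space UNIV) c I"
    and p: "\<And>k. k \<in> I \<Longrightarrow> prob {\<omega> \<in> space M. c k \<omega> = y} = p"
    and p01: "p \<in> {0..1}"
  shows "(\<lambda>\<omega>. card {k \<in> I. c k \<omega> = y}) \<in> measurable M (count_space UNIV)" (is "?X \<in> _")
    and "distr M (count_space UNIV) (\<lambda>\<omega>. card {k \<in> I. c k \<omega> = y}) =
           measure_pmf (binomial_pmf (card I) p)"
proof -
  have rv: "c k \<in> measurable M (count_space UNIV)" if "k \<in> I" for k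
    using indep that by (auto simp: indep_vars_def)
  have ev: "{\<omega> \<in> space M. c k \<omega> = y} \<in> events" if "k \<in> I" for k
    using measurable_sets[OF rv[OF that], of "{y}"]
    by (simp add: vimage_def Int_def conj_commute)
  define P where "P = (\<lambda>S. {\<omega> \<in> space M. {k \<in> I. c k \<omega> = y} = S})"
  have P_eq: "P S = (\<Inter>k\<in>I. c k -` (if k \<in> S then {y} else - {y}) \<inter> space M)"
    if "S \<subseteq> I" "I \<noteq> {}" for S
    using that by (auto simp: P_def split: if_splits)
  have P_ev: "P S \<in> events" if S: "S \<subseteq> I" for S
  proof (cases "I = {}")
    case True
    with S show ?thesis by (simp add: P_def)
  next
    case False
    show ?thesis
      unfolding P_eq[OF S False]
      by (rule sets.finite_INT[OF I False]) (rule measurable_sets[OF rv], simp_all)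
  qed
  have P_prob: "prob (P S) = p ^ card S * (1 - p) ^ (card I - card S)" if S: "S \<subseteq> I" for S
  proof (cases "I = {}")
    case True
    with S show ?thesis by (simp add: P_def prob_space)
  next
    case False
    have "prob (P S) = (\<Prod>k\<in>I. prob (c k -` (if k \<in> S then {y} else - {y}) \<inter> space M))"
      using indep_varsD_finite[OF indep False I, of "\<lambda>k. if k \<in> S then {y} else - {y}"]
      unfolding P_eq[OF S False] by simp
    also have "\<dots> = (\<Prod>k\<in>I. if k \<in> S then p else 1 - p)"
    proof (rule prod.cong[OF refl])
      fix k assume k: "k \<in> I"
      have "c k -` {y} \<inter> space M = {\<omega> \<in> space M. c k \<omega> = y}"
        "c k -` (- {y}) \<inter> space M = space M - {\<omega> \<in> space M. c k \<omega> = y}" by auto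
      thus "prob (c k -` (if k \<in> S then {y} else - {y}) \<inter> space M) = (if k \<in> S then p else 1 - p)"
        using p[OF k] prob_compl[OF ev[OF k]] by simp
    qed
    also have "\<dots> = p ^ card S * (1 - p) ^ (card I - card S)"
    proof -
      have "I \<inter> S = S" "I \<inter> - S = I - S" using S by auto
      thus ?thesis using I S finite_subset[OF S I]
        by (simp add: prod.If_cases card_Diff_subset)
    qed
    finally show ?thesis .
  qed
  have fibre: "?X -` {m} \<inter> space M = (\<Union>S\<in>{S. S \<subseteq> I \<and> card S = m}. P S)" for m
    by (auto simp: P_def)
  have fin: "finite {S. S \<subseteq> I \<and> card S = m}" for m
    using I by simp
  have fibre_ev: "?X -` {m} \<inter> space M \<in> events" for m
    unfolding fibre using fin P_ev by (intro sets.finite_UN) auto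
  show X: "?X \<in> measurable M (count_space UNIV)"
    using fibre_ev by (auto simp: measurable_count_space_eq2_countable)
  show "distr M (count_space UNIV) ?X = measure_pmf (binomial_pmf (card I) p)"
  proof (rule measure_eqI_countable[of _ UNIV])
    fix m :: nat
    have "prob (?X -` {m} \<inter> space M) = (\<Sum>S | S \<subseteq> I \<and> card S = m. prob (P S))"
      unfolding fibre using fin P_ev
      by (intro finite_measure_finite_Union) (auto simp: disjoint_family_on_def P_def)
    also have "\<dots> = (\<Sum>S | S \<subseteq> I \<and> card S = m. p ^ m * (1 - p) ^ (card I - m))"
      by (rule sum.cong) (auto simp: P_prob)
    also have "\<dots> = pmf (binomial_pmf (card I) p) m"
      using p01 by (simp add: n_subsets[OF I])
    finally show "emeasure (distr M (count_space UNIV) ?X) {m} =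
        emeasure (measure_pmf (binomial_pmf (card I) p)) {m}"
      by (simp add: emeasure_distr[OF X] emeasure_eq_measure emeasure_pmf_single)
  qed auto
qed

section \<open>Degree-based indices of the random chain\<close>

theorem theorem4:
  fixes M :: "'w measure" and G :: "'w \<Rightarrow> 'v graph"
    and n :: nat and p1 p2 p3 a :: real
  assumes "n \<ge> 2"
    and "0 < p1" "p1 < 1" "0 < p2" "p2 < 1" "0 < p3" "p3 < 1" "p1 + p2 + p3 = 1"
    and "random_spiro_chain M n p1 p2 p3 G"
  shows "(\<forall>h :: nat \<Rightarrow> real. (\<forall>k\<ge>1. h k > 0) \<longrightarrow>
            (\<forall>\<omega>\<in>space M. vertex_index h a (G \<omega>) =
               2 * h 2 powr a - h 4 powr a + (4 * h 2 powr a + h 4 powr a) * real n))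
       \<and> (\<forall>f :: nat \<Rightarrow> nat \<Rightarrow> real.
            (\<forall>j\<ge>1. \<forall>k\<ge>1. f j k > 0) \<longrightarrow> (\<forall>j\<ge>1. \<forall>k\<ge>1. f j k = f k j) \<longrightarrow>
            (let TI = (\<lambda>\<omega>. edge_index f a (G \<omega>));
                 A = 4 * f 2 2 powr a - 4 * f 2 4 powr a;
                 B = f 2 2 powr a - 2 * f 2 4 powr a + f 4 4 powr a;
                 C = 2 * f 2 2 powr a + 4 * f 2 4 powr a
             in (\<exists>X :: 'w \<Rightarrow> nat.
                   X \<in> measurable M (count_space UNIV) \<and>
                   distr M (count_space UNIV) X = measure_pmf (binomial_pmf (n - 2) p1) \<and>
                   (\<forall>\<omega>\<in>space M. TI \<omega> = A + B * real (X \<omega>) + C * real n)) \<and>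
                prob_space.expectation M TI = A + (B * p1 + C) * real n - 2 * B * p1 \<and>
                prob_space.variance M TI = B\<^sup>2 * p1 * (1 - p1) * (real n - 2)))"
proof -
  from assms(9) have "prob_space M" by (simp add: random_spiro_chain_def)
  then interpret prob_space M .
  from assms(9) obtain c :: "nat \<Rightarrow> 'w \<Rightarrow> nat"
    where indep: "indep_vars (\<lambda>_. count_space UNIV) c {3..n}"
      and prob_1: "\<And>k. k \<in> {3..n} \<Longrightarrow> prob {\<omega> \<in> space M. c k \<omega> = 1} = p1"
      and chain: "\<And>\<omega>. \<omega> \<in> space M \<Longrightarrow> \<exists>L s. spiro_chain (\<lambda>k. c k \<omega>) n (G \<omega>) L s"
    unfolding random_spiro_chain_def by blast
  define X where "X = (\<lambda>\<omega>. card {k \<in> {3..n}. c k \<omega> = 1})"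
  have p01: "p1 \<in> {0..1}" using assms(2,3) by simp
  have card: "card {3..n} = n - 2" using assms(1) by simp
  have X: "X \<in> measurable M (count_space UNIV)"
    unfolding X_def
    by (rule distr_card_indep_eq_binomial(1)[OF finite_atLeastAtMost indep prob_1 p01])
  have distr_X: "distr M (count_space UNIV) X = measure_pmf (binomial_pmf (n - 2) p1)"
    unfolding X_def card[symmetric]
    by (rule distr_card_indep_eq_binomial(2)[OF finite_atLeastAtMost indep prob_1 p01])
  have n2: "real (n - 2) = real n - 2" using assms(1) by (simp add: of_nat_diff)
  have pull: "expectation (\<lambda>\<omega>. \<psi> (X \<omega>)) = measure_pmf.expectation (binomial_pmf (n - 2) p1) \<psi>"
    for \<psi> :: "nat \<Rightarrow> real"
    unfolding distr_X[symmetric] by (rule integral_distr[OF X, symmetric]) simp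
  have int: "integrable M (\<lambda>\<omega>. \<psi> (X \<omega>))" for \<psi> :: "nat \<Rightarrow> real"
    by (rule integrable_distr[OF X]) (unfold distr_X, rule integrable_binomial_pmf[OF p01])
  have EX: "expectation (\<lambda>\<omega>. real (X \<omega>)) = (real n - 2) * p1"
    using pull[of real] by (simp add: expectation_binomial_pmf[OF p01] n2)
  have VX: "variance (\<lambda>\<omega>. real (X \<omega>)) = (real n - 2) * p1 * (1 - p1)"
    using pull[of "\<lambda>k. (real k - (real n - 2) * p1)\<^sup>2"] variance_binomial_pmf[OF p01, of "n - 2"]
    by (simp add: EX expectation_binomial_pmf[OF p01] n2)
  show ?thesis
  proof (intro conjI allI impI ballI)
    fix h :: "nat \<Rightarrow> real" and \<omega>
    assume "\<omega> \<in> space M"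
    then obtain L s where "spiro_chain (\<lambda>k. c k \<omega>) n (G \<omega>) L s" using chain by blast
    thus "vertex_index h a (G \<omega>) =
        2 * h 2 powr a - h 4 powr a + (4 * h 2 powr a + h 4 powr a) * real n"
      by (rule vertex_index_spiro_chain)
  next
    fix f :: "nat \<Rightarrow> nat \<Rightarrow> real"
    assume "\<forall>j\<ge>1. \<forall>k\<ge>1. f j k = f k j"
    hence sym: "f 2 4 = f 4 2" by simp
    define A where "A = 4 * f 2 2 powr a - 4 * f 2 4 powr a"
    define B where "B = f 2 2 powr a - 2 * f 2 4 powr a + f 4 4 powr a"
    define C where "C = 2 * f 2 2 powr a + 4 * f 2 4 powr a"
    have TI: "edge_index f a (G \<omega>) = A + B * real (X \<omega>) + C * real n" if \<omega>: "\<omega> \<in> space M" for \<omega>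
    proof -
      obtain L s where "spiro_chain (\<lambda>k. c k \<omega>) n (G \<omega>) L s" using chain[OF \<omega>] by blast
      from edge_index_spiro_chain[OF this sym] show ?thesis
        by (simp add: A_def B_def C_def X_def)
    qed
    have E: "expectation (\<lambda>\<omega>. edge_index f a (G \<omega>)) = A + (B * p1 + C) * real n - 2 * B * p1"
    proof -
      have "expectation (\<lambda>\<omega>. edge_index f a (G \<omega>)) =
          expectation (\<lambda>\<omega>. (A + C * real n) + B * real (X \<omega>))"
        by (rule Bochner_Integration.integral_cong) (simp_all add: TI)
      also have "\<dots> = (A + C * real n) + B * ((real n - 2) * p1)"
        using int[of real] by (simp add: EX prob_space)
      finally show ?thesis by (simp add: algebra_simps)
    qed
    have V: "variance (\<lambda>\<omega>. edge_index f a (G \<omega>)) = B\<^sup>2 * p1 * (1 - p1) * (real n - 2)"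
    proof -
      have "variance (\<lambda>\<omega>. edge_index f a (G \<omega>)) =
          expectation (\<lambda>\<omega>. B\<^sup>2 * (real (X \<omega>) - (real n - 2) * p1)\<^sup>2)"
        unfolding E
      proof (rule Bochner_Integration.integral_cong)
        fix \<omega> assume "\<omega> \<in> space M"
        hence "edge_index f a (G \<omega>) - (A + (B * p1 + C) * real n - 2 * B * p1) =
            B * (real (X \<omega>) - (real n - 2) * p1)"
          by (simp add: TI algebra_simps)
        thus "(edge_index f a (G \<omega>) - (A + (B * p1 + C) * real n - 2 * B * p1))\<^sup>2 =
            B\<^sup>2 * (real (X \<omega>) - (real n - 2) * p1)\<^sup>2"
          by (simp add: power_mult_distrib)
      qed simp
      also have "\<dots> = B\<^sup>2 * ((real n - 2) * p1 * (1 - p1))"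
        using VX by (simp add: EX)
      finally show ?thesis by (simp add: mult_ac)
    qed
    show "let TI = (\<lambda>\<omega>. edge_index f a (G \<omega>));
                 A = 4 * f 2 2 powr a - 4 * f 2 4 powr a;
                 B = f 2 2 powr a - 2 * f 2 4 powr a + f 4 4 powr a;
                 C = 2 * f 2 2 powr a + 4 * f 2 4 powr a
             in (\<exists>X :: 'w \<Rightarrow> nat.
                   X \<in> measurable M (count_space UNIV) \<and>
                   distr M (count_space UNIV) X = measure_pmf (binomial_pmf (n - 2) p1) \<and>
                   (\<forall>\<omega>\<in>space M. TI \<omega> = A + B * real (X \<omega>) + C * real n)) \<and>
                expectation TI = A + (B * p1 + C) * real n - 2 * B * p1 \<and>
                variance TI = B\<^sup>2 * p1 * (1 - p1) * (real n - 2)"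
      using X distr_X TI E V unfolding Let_def A_def[symmetric] B_def[symmetric] C_def[symmetric]
      by blast
  qed
qed

end
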